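(* Let $p$ be a prime. If $\alpha\in\mathbb C_p$ is algebraic over $\mathbb Q$ or $\alpha\notin\mathbb Z_p$, then for sufficiently large $m$ $$\lim_{N\to\infty}\frac{\sum_{i=m}^N\mathrm{ord}_p(\alpha-i)}{N}=w(\alpha),$$ where $w(\alpha)$, the so-called "weight" of $\alpha$, is given by $$w(\alpha)=\begin{cases}\dfrac{1-p^{-[r(\alpha)]}}{p-1}-\langle r(\alpha)\rangle\, p^{-[r(\alpha)]-1} & \text{if } \alpha\in d(0,1)\setminus\mathbb Z_p,\\[2mm] \dfrac1{p-1} & \text{if }\alpha\in\mathbb Z_p,\\[2mm] \mathrm{ord}_p(\alpha) & \text{if }\alpha\notin d(0,1),\end{cases}$$ with $r(\alpha):=\sup_{i\geq 0}\mathrm{ord}_p(\alpha-i)$, the supremum being over integers $i\ge 0$.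
   Context: $\mathbb C_p$ is the field of complex $p$-adic numbers with $p$-adic absolute value $|\cdot|_p$, and $\mathrm{ord}_p(x)=-\log_p|x|_p$ (logarithm to base $p$) is the corresponding additive valuation. $\mathbb Z_p$ is the ring of $p$-adic integers and $d(0,1)=\{x\in\mathbb C_p: |x|_p\le 1\}$. For a real number $x$, $[x]$ is its integral part and $\langle x\rangle=x-[x]$ its fractional part.
   Formalization: In the first case of w(α) the sign before ⟨r(α)⟩p^{-[r(α)]-1} is plus instead of minus; with minus the claim fails, e.g. for α=√p, where the limit is 1/(2p) but the printed formula gives −1/(2p). *)

theory Defs
  imports "HOL-Analysis.Analysis" "HOL-Computational_Algebra.Computational_Algebra"
begin

text \<open>
  A valued field is given by a type \<^typ>\<open>'k\<close> with a function \<open>v\<close>, the absolute value.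
\<close>

definition padic_top :: "('k::field_char_0 \<Rightarrow> real) \<Rightarrow> 'k topology" where
  "padic_top v = Metric_space.mtopology UNIV (\<lambda>x y. v (x - y))"

text \<open>
  In a complete field extending \<open>(\<rat>, |\<cdot>|\<^sub>p)\<close>, the field of \<open>p\<close>-adic numbers, i.e. the completion
  of \<open>\<rat>\<close>, is the closure of \<open>\<rat>\<close>.
\<close>

definition Qp :: "('k::field_char_0 \<Rightarrow> real) \<Rightarrow> 'k set" where
  "Qp v = padic_top v closure_of \<rat>"

definition Zp :: "('k::field_char_0 \<Rightarrow> real) \<Rightarrow> 'k set" where
  "Zp v = {x \<in> Qp v. v x \<le> 1}"

definition unit_disc :: "('k::field_char_0 \<Rightarrow> real) \<Rightarrow> 'k set" where
  "unit_disc v = {x. v x \<le> 1}"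

definition algebraic_over :: "'k::field_char_0 set \<Rightarrow> 'k \<Rightarrow> bool" where
  "algebraic_over F x \<longleftrightarrow> (\<exists>q. q \<noteq> 0 \<and> (\<forall>i. coeff q i \<in> F) \<and> poly q x = 0)"

definition Qp_bar :: "('k::field_char_0 \<Rightarrow> real) \<Rightarrow> 'k set" where
  "Qp_bar v = {x. algebraic_over (Qp v) x}"

text \<open>
  \<open>is_Cp p v\<close>: the type \<^typ>\<open>'k\<close> with absolute value \<open>v\<close> is the completion of an algebraic
  closure of \<open>\<rat>\<^sub>p\<close>; this determines it up to isometric isomorphism.  The first five clauses say
  that \<open>v\<close> is a non-archimedean absolute value extending the \<open>p\<close>-adic one (on \<open>\<int>\<close>, hence by
  multiplicativity on \<open>\<rat>\<close>), the seventh that \<open>Qp_bar v\<close>, which is algebraic over \<open>Qp v\<close> by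
  definition, is algebraically closed.
\<close>

definition is_Cp :: "nat \<Rightarrow> ('k::field_char_0 \<Rightarrow> real) \<Rightarrow> bool" where
  "is_Cp p v \<longleftrightarrow>
     (\<forall>x. v x \<ge> 0) \<and>
     (\<forall>x. v x = 0 \<longleftrightarrow> x = 0) \<and>
     (\<forall>x y. v (x * y) = v x * v y) \<and>
     (\<forall>x y. v (x + y) \<le> max (v x) (v y)) \<and>
     (\<forall>n::int. n \<noteq> 0 \<longrightarrow> v (of_int n) = 1 / real p ^ multiplicity (int p) n) \<and>
     Metric_space.mcomplete UNIV (\<lambda>x y. v (x - y)) \<and>
     (\<forall>q. degree q > 0 \<and> (\<forall>i. coeff q i \<in> Qp_bar v) \<longrightarrow> (\<exists>x\<in>Qp_bar v. poly q x = 0)) \<and>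
     padic_top v closure_of Qp_bar v = UNIV"

definition padic_ord :: "nat \<Rightarrow> ('k::field_char_0 \<Rightarrow> real) \<Rightarrow> 'k \<Rightarrow> ereal" where
  "padic_ord p v x = (if x = 0 then \<infinity> else ereal (- log (real p) (v x)))"

text \<open>
  The supremum is taken in the extended reals: it is \<open>\<infinity>\<close> on \<open>Zp v\<close> and finite elsewhere.
\<close>

definition padic_r :: "nat \<Rightarrow> ('k::field_char_0 \<Rightarrow> real) \<Rightarrow> 'k \<Rightarrow> ereal" where
  "padic_r p v \<alpha> = (SUP i::nat. padic_ord p v (\<alpha> - of_nat i))"

text \<open>
  Erratum: the source prints the first case with a minus sign before the term containing the
  fractional part of \<open>r\<close>.  That is a misprint.  For \<open>\<alpha> = \<surd>p\<close> one has \<open>r(\<alpha>) = 1/2\<close>, and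
  \<open>ord(\<alpha> - i)\<close> is \<open>1/2\<close> if \<open>p\<close> divides \<open>i\<close> and \<open>0\<close> otherwise, so the mean is \<open>1/(2p)\<close>, whereas the
  printed formula gives \<open>-1/(2p)\<close>.  In general the mean is the integral of \<open>p\<close> to the power
  \<open>-\<lceil>t\<rceil>\<close> over \<open>0 \<le> t \<le> r\<close>, which is the formula below.

  Both real conversions below are applied to finite values only.
\<close>

definition padic_weight :: "nat \<Rightarrow> ('k::field_char_0 \<Rightarrow> real) \<Rightarrow> 'k \<Rightarrow> real" where
  "padic_weight p v \<alpha> =
     (if \<alpha> \<in> unit_disc v - Zp v then
        (let r = real_of_ereal (padic_r p v \<alpha>)
         in (1 - real p powi (- \<lfloor>r\<rfloor>)) / (real p - 1) + frac r * real p powi (- \<lfloor>r\<rfloor> - 1))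
      else if \<alpha> \<in> Zp v then 1 / (real p - 1)
      else real_of_ereal (padic_ord p v \<alpha>))"

end

theory Submission
  imports Defs "HOL-Real_Asymp.Real_Asymp" "HOL-Number_Theory.Cong"
begin

text \<open>
  Write \<open>ord\<close> for the additive valuation. Since \<open>ord(\<alpha> - i) \<ge> j\<close> confines \<open>i\<close> to one residue
  class modulo \<open>p\<^sup>j\<close> (two such \<open>i\<close> differ by an integer of valuation at least \<open>j\<close>), the mean of
  \<open>ord(\<alpha> - i)\<close> is a sum over \<open>j\<close> of densities \<open>p\<^sup>-\<^sup>j\<close> of residue classes; what has to be controlled
  is which \<open>j\<close> occur. There are three cases.

  If \<open>|\<alpha>| > 1\<close>, then \<open>|\<alpha> - i| = |\<alpha>|\<close> for all \<open>i\<close>, so all terms of the sum agree.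

  If \<open>|\<alpha>| \<le> 1\<close> and \<open>\<alpha>\<close> is not a \<open>p\<close>-adic integer, some natural number \<open>a\<close> is nearest to \<open>\<alpha>\<close>
  (\<open>nearest_nat_exists\<close>): a non-minimal value of \<open>|\<alpha> - i|\<close> equals some \<open>|i' - i|\<close>, a power of \<open>p\<close>, so
  an infinite strict descent would put \<open>\<alpha>\<close> into the closure of \<open>\<nat>\<close>, which is the ring of \<open>p\<close>-adic
  integers (\<open>in_Zp_iff\<close>). Then \<open>r = ord(\<alpha> - a)\<close> is the supremum, and the ultrametric inequality gives
  \<open>ord(\<alpha> - i) = min(r, ord(i - a))\<close>. This is a finite combination of indicator functions of residue
  classes: each power \<open>p\<^sup>j\<close> with \<open>1 \<le> j \<le> \<lfloor>r\<rfloor>\<close> contributes its density with weight 1, the next power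
  with weight the fractional part of \<open>r\<close>.

  If \<open>\<alpha>\<close> is a \<open>p\<close>-adic integer, \<open>ord(\<alpha> - i)\<close> is a natural number for \<open>i \<noteq> \<alpha>\<close>, equal to the number of
  \<open>j \<ge> 1\<close> with \<open>i\<close> in a certain class modulo \<open>p\<^sup>j\<close>. Truncating at \<open>j \<le> J\<close> bounds the mean from below,
  and the bounds tend to \<open>1/(p - 1)\<close> as \<open>J\<close> grows. For the upper bound, a class modulo \<open>p\<^sup>j\<close> has at
  most \<open>(N + 1)/p\<^sup>j + 1\<close> members in the range, and the terms \<open>1\<close> add up to the number of \<open>j\<close> that
  occur. Here algebraicity enters, by Liouville's argument (\<open>ord_diff_nat_log_bound\<close>): if
  \<open>q \<in> \<int>[X]\<close> vanishes at \<open>\<alpha>\<close>, then \<open>i - \<alpha>\<close> divides the integer \<open>q(i)\<close> in the ring of integers, and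
  \<open>q(i)\<close> has polynomial size, so only \<open>O(log N)\<close> many \<open>j\<close> occur.
\<close>

section \<open>Counting in residue classes\<close>

text \<open>
  The indicator function of divisibility is the difference of consecutive floors, so that counting
  a residue class telescopes.
\<close>

lemma div_diff_div_pred:
  fixes q x :: int
  assumes "q > 0"
  shows "x div q - (x - 1) div q = of_bool (q dvd x)"
proof (cases "q dvd x")
  case True
  then obtain k where k: "x = q * k" by blast
  have "(x - 1) div q = k - 1"
    using assms by (intro int_div_pos_eq[of _ _ _ "q - 1"]) (simp_all add: k algebra_simps)
  then show ?thesis using assms k by simp
next
  case False
  have x: "x = q * (x div q) + x mod q" by simp
  have "x mod q > 0"
    using False assms by (metis dvd_eq_mod_eq_0 order_le_less pos_mod_sign)
  moreover have "x mod q < q" using assms by simp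
  ultimately have "(x - 1) div q = x div q"
    using assms x by (intro int_div_pos_eq[of _ _ _ "x mod q - 1"]) linarith+
  then show ?thesis using False by simp
qed

lemma sum_of_bool_dvd:
  fixes q a :: int and m N :: nat
  assumes "q > 0" "m \<le> Suc N"
  shows "(\<Sum>i=m..N. of_bool (q dvd int i - a)) = (int N - a) div q - (int m - 1 - a) div q"
proof -
  have "(\<Sum>i=m..N. of_bool (q dvd int i - a))
      = (\<Sum>i=m..N. (int (Suc i) - 1 - a) div q - (int i - 1 - a) div q)"
    by (intro sum.cong refl, subst div_diff_div_pred[OF assms(1), symmetric])
       (simp add: algebra_simps)
  also have "\<dots> = (int N - a) div q - (int m - 1 - a) div q"
    by (subst sum_Suc_diff[OF assms(2)]) simp
  finally show ?thesis .
qed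

lemma residue_class_count_bounds:
  fixes q a :: int and m N :: nat
  assumes "q > 0" "m \<le> Suc N"
  shows "\<bar>(\<Sum>i=m..N. of_bool (q dvd int i - a)) - (real N + 1 - real m) / real_of_int q\<bar> \<le> 1"
proof -
  have fl: "real_of_int x / real_of_int q - 1 < real_of_int (x div q) \<and>
            real_of_int (x div q) \<le> real_of_int x / real_of_int q" for x :: int
    using floor_correct[of "real_of_int x / real_of_int q"]
    by (simp add: floor_divide_of_int_eq)
  have "(\<Sum>i=m..N. of_bool (q dvd int i - a)) =
        real_of_int (\<Sum>i=m..N. of_bool (q dvd int i - a))"
    by simp
  also have "\<dots> = real_of_int ((int N - a) div q) - real_of_int ((int m - 1 - a) div q)"
    by (simp add: sum_of_bool_dvd[OF assms])
  finally have "(\<Sum>i=m..N. of_bool (q dvd int i - a)) =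
     real_of_int ((int N - a) div q) - real_of_int ((int m - 1 - a) div q)" .
  moreover have "real_of_int (int N - a) / real_of_int q - real_of_int (int m - 1 - a) / real_of_int q
      = (real N + 1 - real m) / real_of_int q"
    by (simp add: diff_divide_distrib[symmetric])
  ultimately show ?thesis
    using fl[of "int N - a"] fl[of "int m - 1 - a"] by linarith
qed

lemma residue_class_density:
  fixes q a :: int and m :: nat
  assumes "q > 0"
  shows "(\<lambda>N. (\<Sum>i=m..N. of_bool (q dvd int i - a)) / real N) \<longlonglongrightarrow> 1 / real_of_int q"
proof (rule real_tendsto_sandwich)
  define Q where "Q = real_of_int q"
  have Q: "Q > 0" using assms by (simp add: Q_def)
  have bd: "\<bar>(\<Sum>i=m..N. of_bool (q dvd int i - a)) - (real N + 1 - real m) / Q\<bar> \<le> 1"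
    if "N \<ge> m" for N
    using residue_class_count_bounds[OF assms, of m N a] that by (simp add: Q_def)
  show "\<forall>\<^sub>F N in sequentially. ((real N + 1 - real m) / Q - 1) / real N
          \<le> (\<Sum>i=m..N. of_bool (q dvd int i - a)) / real N"
    using eventually_ge_at_top[of m] by eventually_elim (use bd in \<open>force intro: divide_right_mono\<close>)
  show "\<forall>\<^sub>F N in sequentially. (\<Sum>i=m..N. of_bool (q dvd int i - a)) / real N
          \<le> ((real N + 1 - real m) / Q + 1) / real N"
    using eventually_ge_at_top[of m] by eventually_elim (use bd in \<open>force intro: divide_right_mono\<close>)
  show "(\<lambda>N. ((real N + 1 - real m) / Q - 1) / real N) \<longlonglongrightarrow> 1 / real_of_int q"
    unfolding Q_def[symmetric] using Q by (real_asymp simp: divide_inverse)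
  show "(\<lambda>N. ((real N + 1 - real m) / Q + 1) / real N) \<longlonglongrightarrow> 1 / real_of_int q"
    unfolding Q_def[symmetric] using Q by (real_asymp simp: divide_inverse)
qed

section \<open>Truncations as sums of indicators\<close>

lemma sum_inverse_powers:
  fixes x :: real
  assumes "x > 1"
  shows "(\<Sum>j=1..K. 1 / x ^ j) = (1 - 1 / x ^ K) / (x - 1)"
proof (induction K)
  case (Suc K)
  have "(1 - 1 / x ^ K) / (x - 1) + 1 / x ^ Suc K = (1 - 1 / x ^ Suc K) / (x - 1)"
    using assms by (simp add: divide_simps) (simp add: algebra_simps)
  then show ?case using Suc by simp
qed simp

lemma sum_of_bool_le:
  "(\<Sum>j=1..K. of_bool (j \<le> n)) = real (min K n)"
proof -
  have "(\<Sum>j=1..K. of_bool (j \<le> n)) = (\<Sum>j\<in>{1..min K n}. (1::real))"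
    by (rule sum.mono_neutral_cong_right) auto
  then show ?thesis by simp
qed

text \<open>
  As \<open>n\<close> is a natural number, truncating it at \<open>r\<close> either leaves it alone, when
  \<open>n \<le> \<lfloor>r\<rfloor>\<close>, or gives \<open>r\<close>, the fractional part being gained exactly at the step to
  \<open>\<lfloor>r\<rfloor> + 1\<close>.
\<close>

lemma min_eq_sum_of_bool:
  fixes r :: real and n :: nat
  assumes "r \<ge> 0"
  shows "min r (real n) = (\<Sum>j=1..nat \<lfloor>r\<rfloor>. of_bool (j \<le> n)) + frac r * of_bool (Suc (nat \<lfloor>r\<rfloor>) \<le> n)"
proof -
  have K: "real (nat \<lfloor>r\<rfloor>) = r - frac r" using assms by (simp add: frac_def)
  show ?thesis
  proof (cases "Suc (nat \<lfloor>r\<rfloor>) \<le> n")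
    case True
    then have "real (nat \<lfloor>r\<rfloor>) + 1 \<le> real n" by linarith
    then have "r \<le> real n" using K frac_lt_1[of r] by linarith
    then show ?thesis using True K unfolding sum_of_bool_le by simp
  next
    case False
    then have "real n \<le> real (nat \<lfloor>r\<rfloor>)" by linarith
    then have "real n \<le> r" using K frac_ge_0[of r] by linarith
    then show ?thesis using False unfolding sum_of_bool_le by simp
  qed
qed

section \<open>Non-archimedean absolute values extending the p-adic one\<close>

locale padic_absolute_value =
  fixes p :: nat and v :: "'k::field_char_0 \<Rightarrow> real"
  assumes prime_p: "prime p"
    and v_nonneg: "v x \<ge> 0"
    and v_eq_0_iff: "v x = 0 \<longleftrightarrow> x = 0"
    and v_mult: "v (x * y) = v x * v y"
    and v_add_le: "v (x + y) \<le> max (v x) (v y)"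
    and v_of_int_nonzero: "n \<noteq> 0 \<Longrightarrow> v (of_int n) = 1 / real p ^ multiplicity (int p) n"
begin

lemma p_gt_1: "real p > 1"
  using prime_gt_1_nat[OF prime_p] by simp

lemma v_0 [simp]: "v 0 = 0"
  by (simp add: v_eq_0_iff)

lemma v_pos: "x \<noteq> 0 \<Longrightarrow> v x > 0"
  using v_nonneg[of x] v_eq_0_iff[of x] by linarith

lemma v_minus: "v (- x) = v x"
proof -
  have "v (- 1) = 1" using v_of_int_nonzero[of "- 1"] by simp
  then show ?thesis using v_mult[of "- 1" x] by simp
qed

lemma v_minus_commute: "v (x - y) = v (y - x)"
  using v_minus[of "x - y"] by simp

lemma v_diff_le: "v (x - z) \<le> max (v (x - y)) (v (y - z))"
  using v_add_le[of "x - y" "y - z"] by simp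

text \<open>
  Every ultrametric triangle is isosceles: the two sides other than a strictly shortest one agree.
\<close>

lemma v_diff_eq: "v (x - y) < v (x - z) \<Longrightarrow> v (y - z) = v (x - z)"
  using v_diff_le[of x z y] v_diff_le[of y z x] v_minus_commute[of x y] by linarith

lemma v_of_int_le_iff: "v (of_int n) \<le> 1 / real p ^ j \<longleftrightarrow> int p ^ j dvd n"
proof (cases "n = 0")
  case False
  have pr: "prime (int p)" using prime_p by simp
  have "v (of_int n) \<le> 1 / real p ^ j \<longleftrightarrow> real p ^ j \<le> real p ^ multiplicity (int p) n"
    using False p_gt_1 by (simp add: v_of_int_nonzero field_simps)
  also have "\<dots> \<longleftrightarrow> j \<le> multiplicity (int p) n"
    using p_gt_1 by (intro power_increasing_iff) auto
  also have "\<dots> \<longleftrightarrow> int p ^ j dvd n"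
    using pr False by (subst power_dvd_iff_le_multiplicity) auto
  finally show ?thesis .
qed (use p_gt_1 in simp)

lemma v_of_int_le_1: "v (of_int n) \<le> 1"
  using v_of_int_le_iff[of n 0] by simp

lemma v_of_nat_le_1: "v (of_nat n) \<le> 1"
  using v_of_int_le_1[of "int n"] by simp

lemma Metric_space_v: "Metric_space UNIV (\<lambda>x y. v (x - y))"
proof
  show "v (x - z) \<le> v (x - y) + v (y - z)" for x y z
    using v_diff_le[of x z y] v_nonneg[of "x - y"] v_nonneg[of "y - z"] by linarith
qed (auto simp: v_nonneg v_minus_commute v_eq_0_iff)

lemma in_Qp_iff: "x \<in> Qp v \<longleftrightarrow> (\<forall>e>0. \<exists>y\<in>\<rat>. v (x - y) < e)"
proof -
  interpret Metric_space UNIV "\<lambda>x y. v (x - y)" by (rule Metric_space_v)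
  show ?thesis unfolding Qp_def padic_top_def metric_closure_of by (simp add: mball_def)
qed

lemma inverse_p_power_lt:
  assumes "e > 0" obtains k where "1 / real p ^ k < e"
proof -
  have "1 / real p < 1" using p_gt_1 by simp
  then obtain k where "(1 / real p) ^ k < e"
    using real_arch_pow_inv[OF assms, of "1 / real p"] by blast
  then show ?thesis using that by (simp add: power_one_over)
qed

text \<open>
  The denominator of a \<open>p\<close>-integral rational is prime to \<open>p\<close>, hence invertible modulo \<open>p\<^sup>k\<close>.
\<close>

lemma rational_near_nat:
  assumes "x \<in> \<rat>" "v x \<le> 1"
  shows "\<exists>n. v (x - of_nat n) \<le> 1 / real p ^ k"
proof -
  obtain r :: rat where r: "x = of_rat r" using assms(1) by (auto elim: Rats_cases)
  obtain a b where ab: "quotient_of r = (a, b)" by fastforce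
  have b: "b > 0" "coprime a b" "r = of_int a / of_int b"
    using ab quotient_of_denom_pos quotient_of_coprime quotient_of_div by auto
  have x: "x * of_int b = of_int a" using b by (simp add: r of_rat_divide)
  have vb0: "v (of_int b) > 0" using b by (intro v_pos) simp
  have pr: "prime (int p)" using prime_p by simp
  have ndvd: "\<not> int p dvd b"
  proof
    assume d: "int p dvd b"
    have "v (of_int a) \<le> v (of_int b)"
      using assms(2) vb0 by (simp add: x[symmetric] v_mult mult_left_le_one_le v_nonneg)
    also have "\<dots> \<le> 1 / real p ^ 1" using d v_of_int_le_iff[of b 1] by simp
    finally have "int p dvd a" using v_of_int_le_iff[of a 1] by simp
    then show False using d b(2) pr by (meson coprime_common_divisor not_prime_unit)
  qed
  have vb: "v (of_int b) = 1"
    using b ndvd by (simp add: v_of_int_nonzero not_dvd_imp_multiplicity_0)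
  have "coprime b (int p ^ k)"
    using prime_imp_coprime[OF pr ndvd] by (simp add: coprime_commute)
  then obtain c where c: "[b * c = 1] (mod int p ^ k)"
    using cong_solve_coprime_int by blast
  define n where "n = nat ((a * c) mod int p ^ k)"
  have n: "int n = (a * c) mod int p ^ k"
    using p_gt_1 by (simp add: n_def)
  have "[a - b * int n = a - b * (a * c)] (mod int p ^ k)"
    unfolding n by (intro cong_diff cong_mult) (auto simp: cong_def)
  also have "[a - b * (a * c) = a - a * 1] (mod int p ^ k)"
    using cong_mult[OF cong_refl[of a] c] by (intro cong_diff) (auto simp: ac_simps)
  finally have d: "int p ^ k dvd a - b * int n" by (simp add: cong_0_iff)
  have "v (x - of_nat n) = v ((x - of_nat n) * of_int b)" by (simp add: v_mult vb)
  also have "(x - of_nat n) * of_int b = of_int (a - b * int n)"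
    by (simp add: algebra_simps x)
  also have "v (of_int (a - b * int n)) \<le> 1 / real p ^ k"
    using d by (simp only: v_of_int_le_iff)
  finally show ?thesis by blast
qed

text \<open>
  \<open>\<int>\<^sub>p\<close>, introduced as the unit ball of the closure of \<open>\<rat>\<close>, is the closure of \<open>\<nat>\<close>. This
  reduces questions about \<open>\<int>\<^sub>p\<close> to congruences modulo powers of \<open>p\<close>.
\<close>

lemma in_Zp_iff: "x \<in> Zp v \<longleftrightarrow> (\<forall>k. \<exists>n. v (x - of_nat n) \<le> 1 / real p ^ k)"
proof
  assume x: "x \<in> Zp v"
  show "\<forall>k. \<exists>n. v (x - of_nat n) \<le> 1 / real p ^ k"
  proof
    fix k
    have "1 / real p ^ k > 0" using p_gt_1 by simp
    moreover have "\<forall>e>0. \<exists>y\<in>\<rat>. v (x - y) < e"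
      using x by (simp add: Zp_def in_Qp_iff)
    ultimately obtain y where y: "y \<in> \<rat>" "v (x - y) < 1 / real p ^ k"
      by blast
    have "1 / real p ^ k \<le> 1" using p_gt_1 by simp
    moreover have "v x \<le> 1" using x by (simp add: Zp_def)
    ultimately have "v y \<le> 1"
      using y v_diff_le[of y 0 x] v_minus_commute[of x y] by simp
    then obtain n where "v (y - of_nat n) \<le> 1 / real p ^ k"
      using rational_near_nat y(1) by blast
    then have "v (x - of_nat n) \<le> 1 / real p ^ k"
      using y(2) v_diff_le[of x "of_nat n" y] by simp
    then show "\<exists>n. v (x - of_nat n) \<le> 1 / real p ^ k" by blast
  qed
next
  assume n: "\<forall>k. \<exists>n. v (x - of_nat n) \<le> 1 / real p ^ k"
  obtain n where "v (x - of_nat n) \<le> 1" using n[rule_format, of 0] by auto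
  then have "v x \<le> 1" using v_diff_le[of x 0 "of_nat n"] v_of_nat_le_1[of n] by simp
  moreover have "x \<in> Qp v"
    unfolding in_Qp_iff
  proof (intro allI impI)
    fix e :: real assume "e > 0"
    then obtain k where "1 / real p ^ k < e" by (rule inverse_p_power_lt)
    moreover obtain n where "v (x - of_nat n) \<le> 1 / real p ^ k" using n by blast
    ultimately show "\<exists>y\<in>\<rat>. v (x - y) < e" by (intro bexI[of _ "of_nat n"]) auto
  qed
  ultimately show "x \<in> Zp v" by (simp add: Zp_def)
qed

lemma of_nat_in_Zp: "of_nat n \<in> Zp v"
  unfolding in_Zp_iff using p_gt_1 by (intro allI exI[of _ n]) simp

text \<open>
  The real-valued version of the valuation; its value at \<open>0\<close> is a default, and it is applied to
  nonzero arguments only.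
\<close>

definition ord :: "'k \<Rightarrow> real" where
  "ord x = - log (real p) (v x)"

lemma padic_ord_eq: "x \<noteq> 0 \<Longrightarrow> padic_ord p v x = ereal (ord x)"
  by (simp add: padic_ord_def ord_def)

lemma ord_le_iff: "x \<noteq> 0 \<Longrightarrow> y \<noteq> 0 \<Longrightarrow> ord x \<le> ord y \<longleftrightarrow> v y \<le> v x"
  using p_gt_1 by (simp add: ord_def v_pos)

lemma nat_le_ord_iff:
  assumes "x \<noteq> 0"
  shows "real j \<le> ord x \<longleftrightarrow> v x \<le> 1 / real p ^ j"
proof -
  have "real j \<le> ord x \<longleftrightarrow> log (real p) (v x) \<le> - real j"
    by (auto simp: ord_def)
  also have "\<dots> \<longleftrightarrow> v x \<le> real p powr (- real j)"
    using p_gt_1 v_pos[OF assms] by (simp add: log_le_iff)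
  also have "real p powr (- real j) = 1 / real p ^ j"
    using p_gt_1 by (simp add: powr_minus_divide powr_realpow)
  finally show ?thesis .
qed

lemma ord_nonneg: "x \<noteq> 0 \<Longrightarrow> v x \<le> 1 \<Longrightarrow> 0 \<le> ord x"
  using nat_le_ord_iff[of x 0] by simp

lemma ord_of_int: "n \<noteq> 0 \<Longrightarrow> ord (of_int n) = real (multiplicity (int p) n)"
  using p_gt_1 by (simp add: ord_def v_of_int_nonzero log_divide log_nat_power)


section \<open>The unit disc outside the p-adic integers\<close>

text \<open>
  If \<open>b\<close> is not nearest, say \<open>c\<close> is nearer, then \<open>|x - b| = |c - b|\<close> is a power of \<open>p\<close>. Without a
  nearest natural number each improvement would therefore gain at least a factor \<open>p\<close>, and \<open>x\<close> would
  be a limit of natural numbers.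
\<close>

lemma nearest_nat_exists:
  assumes "v x \<le> 1" "x \<notin> Zp v"
  shows "\<exists>a. \<forall>i. v (x - of_nat a) \<le> v (x - of_nat i)"
proof (rule ccontr)
  assume "\<not> ?thesis"
  then have closer: "\<exists>i. v (x - of_nat i) < v (x - of_nat a)" for a
    by (meson not_le)
  have "\<exists>a. v (x - of_nat a) \<le> 1 / real p ^ k" for k
  proof (induction k)
    case 0
    show ?case using assms(1) by (intro exI[of _ 0]) simp
  next
    case (Suc k)
    then obtain a where a: "v (x - of_nat a) \<le> 1 / real p ^ k" by blast
    obtain b where b: "v (x - of_nat b) < v (x - of_nat a)" using closer by blast
    \<comment> \<open>The point \<open>c\<close> only serves to show that \<open>|x - b|\<close> is a power of \<open>p\<close>.\<close>
    obtain c where c: "v (x - of_nat c) < v (x - of_nat b)" using closer by blast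
    have ne: "int c - int b \<noteq> 0" using c by auto
    have eq: "v (x - of_nat b) = v (of_int (int c - int b))"
      using v_diff_eq[OF c] by simp
    have "1 / real p ^ multiplicity (int p) (int c - int b) < 1 / real p ^ k"
      using a b eq v_of_int_nonzero[OF ne] by simp
    then have "real p ^ k < real p ^ multiplicity (int p) (int c - int b)"
      using p_gt_1 by (simp add: field_simps)
    then have "k < multiplicity (int p) (int c - int b)"
      using p_gt_1 power_less_imp_less_exp by blast
    then have "int p ^ Suc k dvd int c - int b"
      by (intro multiplicity_dvd') simp
    then have "v (x - of_nat b) \<le> 1 / real p ^ Suc k"
      unfolding eq v_of_int_le_iff .
    then show ?case by blast
  qed
  then show False using assms(2) in_Zp_iff by blast
qed

text \<open>
  The inequality \<open>\<ge>\<close> holds because \<open>|i - a| \<le> max(|x - i|, |x - a|) = |x - i|\<close> by minimality.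
\<close>

lemma v_diff_nearest:
  assumes "\<And>i. v (x - of_nat a) \<le> v (x - of_nat i)"
  shows "v (x - of_nat i) = max (v (x - of_nat a)) (v (of_int (int i - int a)))"
  using assms[of i] v_diff_le[of x "of_nat i" "of_nat a"] v_diff_le[of "of_nat i" "of_nat a" x]
    v_minus_commute[of "of_nat i" "of_nat a"] v_minus_commute[of "of_nat i" x]
  by simp

text \<open>
  By \<open>v_diff_nearest\<close>, \<open>ord(x - i)\<close> is the minimum of \<open>r\<close> and the valuation of the integer
  \<open>i - a\<close>, which is then expanded into indicators of divisibility by powers of \<open>p\<close>. For \<open>i = a\<close>
  all indicators are 1 and both sides equal \<open>r\<close>.
\<close>

lemma ord_diff_nearest:
  fixes x a
  defines "r \<equiv> ord (x - of_nat a)"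
  defines "K \<equiv> nat \<lfloor>r\<rfloor>"
  assumes "v x \<le> 1" "x \<notin> Zp v"
    and nearest: "\<And>i. v (x - of_nat a) \<le> v (x - of_nat i)"
  shows "ord (x - of_nat i) =
    (\<Sum>j=1..K. of_bool (int p ^ j dvd int i - int a)) +
    frac r * of_bool (int p ^ Suc K dvd int i - int a)"
proof -
  have ne: "x - of_nat i \<noteq> 0" for i using assms(4) of_nat_in_Zp by auto
  have va: "v (x - of_nat a) \<le> 1"
    using nearest[of 0] assms(3) by simp
  have r: "r \<ge> 0" unfolding r_def using ne va by (rule ord_nonneg)
  show ?thesis
  proof (cases "i = a")
    case True
    have "real K = r - frac r" using r by (simp add: K_def frac_def)
    then show ?thesis using True by (simp add: r_def)
  next
    case False
    define n where "n = multiplicity (int p) (int i - int a)"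
    have ne': "int i - int a \<noteq> 0" using False by simp
    have dvd: "int p ^ j dvd int i - int a \<longleftrightarrow> j \<le> n" for j
      unfolding n_def using ne' prime_p
      by (subst power_dvd_iff_le_multiplicity) auto
    have "ord (x - of_nat i) = min r (ord (of_int (int i - int a)))"
      unfolding r_def ord_def v_diff_nearest[OF nearest, of i]
      using p_gt_1 v_pos[OF ne[of a]] v_pos[of "of_int (int i - int a)"] ne'
      by (auto simp: max_def min_def)
    also have "ord (of_int (int i - int a)) = real n"
      unfolding n_def by (rule ord_of_int[OF ne'])
    also have "min r (real n) = (\<Sum>j=1..K. of_bool (j \<le> n)) + frac r * of_bool (Suc K \<le> n)"
      unfolding K_def by (rule min_eq_sum_of_bool[OF r])
    finally show ?thesis by (simp only: dvd)
  qed
qed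

lemma mean_ord_outside_Zp:
  fixes x a
  defines "r \<equiv> ord (x - of_nat a)"
  defines "K \<equiv> nat \<lfloor>r\<rfloor>"
  assumes "v x \<le> 1" "x \<notin> Zp v"
    and nearest: "\<And>i. v (x - of_nat a) \<le> v (x - of_nat i)"
  shows "(\<lambda>N. (\<Sum>i=m..N. ord (x - of_nat i)) / real N) \<longlonglongrightarrow>
    (1 - 1 / real p ^ K) / (real p - 1) + frac r / real p ^ Suc K"
proof -
  define c where "c j N = (\<Sum>i=m..N. of_bool (int p ^ j dvd int i - int a)) / real N" for j N
  have c: "c j \<longlonglongrightarrow> 1 / real p ^ j" for j
    unfolding c_def using residue_class_density[of "int p ^ j" "int a" m] p_gt_1 by simp
  have "(\<Sum>i=m..N. ord (x - of_nat i)) / real N = (\<Sum>j=1..K. c j N) + frac r * c (Suc K) N" for N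
  proof -
    have "(\<Sum>i=m..N. ord (x - of_nat i)) =
       (\<Sum>i=m..N. \<Sum>j=1..K. of_bool (int p ^ j dvd int i - int a)) +
       frac r * (\<Sum>i=m..N. of_bool (int p ^ Suc K dvd int i - int a))"
      unfolding sum_distrib_left sum.distrib[symmetric] r_def K_def
      by (intro sum.cong refl ord_diff_nearest assms)
    also have "(\<Sum>i=m..N. \<Sum>j=1..K. of_bool (int p ^ j dvd int i - int a)) =
       (\<Sum>j=1..K. (\<Sum>i=m..N. of_bool (int p ^ j dvd int i - int a) :: real))"
      by (rule sum.swap)
    finally show ?thesis
      by (simp add: c_def add_divide_distrib sum_divide_distrib)
  qed
  moreover have "(\<lambda>N. (\<Sum>j=1..K. c j N) + frac r * c (Suc K) N) \<longlonglongrightarrow>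
     (\<Sum>j=1..K. 1 / real p ^ j) + frac r * (1 / real p ^ Suc K)"
    by (intro tendsto_intros c)
  ultimately show ?thesis
    using sum_inverse_powers[OF p_gt_1, of K] by simp
qed

section \<open>A Liouville bound for algebraic elements\<close>

lemma v_poly_le_1: "v x \<le> 1 \<Longrightarrow> v (poly (map_poly of_int q) x) \<le> 1"
proof (induction q)
  case (pCons c q)
  then have "v (x * poly (map_poly of_int q) x) \<le> 1"
    by (simp add: v_mult mult_le_one v_nonneg)
  then show ?case
    using v_add_le[of "of_int c" "x * poly (map_poly of_int q) x"] v_of_int_le_1[of c]
    by (simp add: map_poly_pCons)
qed simp

text \<open>
  \<open>x - y\<close> divides \<open>q(x) - q(y)\<close> with an integral cofactor. The induction uses
  \<open>x g(x) - y g(y) = x (g(x) - g(y)) + (x - y) g(y)\<close>.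
\<close>

lemma v_poly_diff_le:
  assumes "v x \<le> 1" "v y \<le> 1"
  shows "v (poly (map_poly of_int q) x - poly (map_poly of_int q) y) \<le> v (x - y)"
proof (induction q)
  case 0
  show ?case by (simp add: v_nonneg)
next
  case (pCons c q)
  define f where "f z = poly (map_poly (of_int :: int \<Rightarrow> 'k) q) z" for z
  have "v (x * (f x - f y)) \<le> v (x - y)"
    unfolding v_mult using mult_mono[OF assms(1) pCons(2)] by (simp add: v_nonneg f_def)
  moreover have "v ((x - y) * f y) \<le> v (x - y)"
    using v_poly_le_1[OF assms(2), of q] by (simp add: v_mult f_def mult_right_le_one_le v_nonneg)
  ultimately have "v (x * (f x - f y) + (x - y) * f y) \<le> v (x - y)"
    using v_add_le[of "x * (f x - f y)" "(x - y) * f y"] by linarith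
  moreover have "poly (map_poly of_int (pCons c q)) x - poly (map_poly of_int (pCons c q)) y =
      x * (f x - f y) + (x - y) * f y"
    using pCons(1) by (simp add: map_poly_pCons f_def algebra_simps)
  ultimately show ?case by simp
qed

end

lemma poly_int_growth:
  fixes q :: "int poly"
  shows "\<exists>C\<ge>1. \<forall>i. real_of_int \<bar>poly q (int i)\<bar> \<le> C * (real i + 1) ^ degree q"
proof -
  define C where "C = 1 + (\<Sum>k\<le>degree q. real_of_int \<bar>coeff q k\<bar>)"
  have "real_of_int \<bar>poly q (int i)\<bar> \<le> C * (real i + 1) ^ degree q" for i
  proof -
    have "real_of_int \<bar>poly q (int i)\<bar> = \<bar>\<Sum>k\<le>degree q. real_of_int (coeff q k) * real i ^ k\<bar>"
      by (simp add: poly_altdef)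
    also have "\<dots> \<le> (\<Sum>k\<le>degree q. \<bar>real_of_int (coeff q k) * real i ^ k\<bar>)"
      by (rule sum_abs)
    also have "\<dots> \<le> (\<Sum>k\<le>degree q. real_of_int \<bar>coeff q k\<bar> * (real i + 1) ^ degree q)"
    proof (rule sum_mono)
      fix k assume k: "k \<in> {..degree q}"
      have "real i ^ k \<le> (real i + 1) ^ k" by (rule power_mono) auto
      also have "\<dots> \<le> (real i + 1) ^ degree q" using k by (intro power_increasing) auto
      finally show "\<bar>real_of_int (coeff q k) * real i ^ k\<bar> \<le>
          real_of_int \<bar>coeff q k\<bar> * (real i + 1) ^ degree q"
        by (simp add: abs_mult mult_left_mono)
    qed
    also have "\<dots> \<le> C * (real i + 1) ^ degree q"
      by (simp add: C_def sum_distrib_right[symmetric] distrib_right)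
    finally show ?thesis .
  qed
  moreover have "C \<ge> 1" by (simp add: C_def sum_nonneg)
  ultimately show ?thesis by blast
qed

context padic_absolute_value
begin

text \<open>
  An algebraic \<open>x\<close> cannot be approximated too well by natural numbers: for an integer polynomial
  \<open>q\<close> with root \<open>x\<close>, the valuation of \<open>x - i\<close> is at most that of the integer \<open>q(i)\<close>, and a nonzero
  integer divisible by \<open>p\<^sup>n\<close> has size at least \<open>p\<^sup>n\<close>. The finitely many \<open>i\<close> with \<open>q(i) = 0\<close>
  are excluded by \<open>M\<close>. If \<open>x\<close> is a natural number, it is one of them, and the infinite valuation
  at \<open>i = x\<close> is what forces the mean to start at a large \<open>m\<close>.
\<close>

lemma ord_diff_nat_log_bound:
  assumes "algebraic x" "v x \<le> 1"
  shows "\<exists>C\<ge>1. \<exists>d M. \<forall>i\<ge>M. x \<noteq> of_nat i \<and>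
           ord (x - of_nat i) \<le> log (real p) (C * (real i + 1) ^ d)"
proof -
  obtain q :: "int poly" where q: "q \<noteq> 0" "poly (map_poly of_int q) x = 0"
    using assms(1) by (rule algebraicE')
  obtain C where C: "C \<ge> 1" "\<And>i. real_of_int \<bar>poly q (int i)\<bar> \<le> C * (real i + 1) ^ degree q"
    using poly_int_growth[of q] by blast
  have "finite {i::nat. poly q (int i) = 0}"
    using finite_vimageI[OF poly_roots_finite[OF q(1)], of int] by (simp add: vimage_def inj_def)
  then obtain M where M: "\<And>i. i \<ge> M \<Longrightarrow> poly q (int i) \<noteq> 0"
    unfolding finite_nat_set_iff_bounded by (metis mem_Collect_eq not_le)
  have poly_nat: "poly (map_poly of_int q) (of_nat i) = (of_int (poly q (int i)) :: 'k)" for i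
    by (induction q) (simp_all add: map_poly_pCons)
  have "x \<noteq> of_nat i \<and> ord (x - of_nat i) \<le> log (real p) (C * (real i + 1) ^ degree q)"
    if i: "i \<ge> M" for i
  proof
    define n where "n = poly q (int i)"
    have n0: "n \<noteq> 0" using M[OF i] by (simp add: n_def)
    show ne: "x \<noteq> of_nat i" using q(2) n0 poly_nat[of i] by (auto simp: n_def)
    have "v (of_int n) \<le> v (x - of_nat i)"
      using v_poly_diff_le[OF v_of_nat_le_1[of i] assms(2), of q] q(2) poly_nat[of i]
        v_minus_commute[of x "of_nat i"] by (simp add: n_def)
    then have "ord (x - of_nat i) \<le> ord (of_int n)"
      using ne n0 by (subst ord_le_iff) auto
    also have "\<dots> = log (real p) (real p ^ multiplicity (int p) n)"
      using p_gt_1 by (simp add: ord_of_int[OF n0] log_nat_power)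
    also have "\<dots> \<le> log (real p) (real_of_int \<bar>n\<bar>)"
    proof -
      have "int p ^ multiplicity (int p) n \<le> \<bar>n\<bar>"
        using n0 multiplicity_dvd[of "int p" n] by (intro zdvd_imp_le) auto
      then have "real p ^ multiplicity (int p) n \<le> real_of_int \<bar>n\<bar>"
        by (metis of_int_le_iff of_int_of_nat_eq of_int_power)
      then show ?thesis using p_gt_1 n0 by (subst log_le_cancel_iff) auto
    qed
    also have "\<dots> \<le> log (real p) (C * (real i + 1) ^ degree q)"
      using p_gt_1 n0 C(1) C(2)[of i] by (subst log_le_cancel_iff) (auto simp: n_def)
    finally show "ord (x - of_nat i) \<le> log (real p) (C * (real i + 1) ^ degree q)" .
  qed
  then show ?thesis using C(1) by blast
qed

section \<open>Algebraic p-adic integers\<close>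

text \<open>
  A natural number nearer to \<open>x\<close> than \<open>i\<close> is can take the place of \<open>x\<close> in \<open>x - i\<close>.
\<close>

lemma ord_in_Zp_is_nat:
  assumes "x \<in> Zp v" "x \<noteq> of_nat i"
  shows "\<exists>n. ord (x - of_nat i) = real n"
proof -
  have "v (x - of_nat i) > 0" using assms(2) by (simp add: v_pos)
  then obtain k where k: "1 / real p ^ k < v (x - of_nat i)" by (rule inverse_p_power_lt)
  obtain n where "v (x - of_nat n) \<le> 1 / real p ^ k" using assms(1) in_Zp_iff by blast
  then have "v (of_nat n - of_nat i) = v (x - of_nat i)" using k by (intro v_diff_eq) simp
  then have eq: "v (x - of_nat i) = v (of_int (int n - int i))" by simp
  then have "int n - int i \<noteq> 0" using assms(2) v_pos[of "x - of_nat i"] by (intro notI) simp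
  then show ?thesis using eq ord_of_int[of "int n - int i"] by (auto simp: ord_def)
qed

lemma nat_le_ord_iff_residue:
  assumes "x \<noteq> of_nat i" "v (x - of_nat a) \<le> 1 / real p ^ j"
  shows "real j \<le> ord (x - of_nat i) \<longleftrightarrow> int p ^ j dvd int i - int a"
proof -
  have "real j \<le> ord (x - of_nat i) \<longleftrightarrow> v (x - of_nat i) \<le> 1 / real p ^ j"
    using assms(1) by (intro nat_le_ord_iff) simp
  also have "\<dots> \<longleftrightarrow> v (of_int (int i - int a)) \<le> 1 / real p ^ j"
    using assms(2) v_diff_le[of x "of_nat i" "of_nat a"] v_diff_le[of "of_nat i" "of_nat a" x]
      v_minus_commute[of "of_nat i" "of_nat a"] v_minus_commute[of "of_nat i" x]
    by auto
  finally show ?thesis by (simp only: v_of_int_le_iff)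
qed

text \<open>
  The truncated count of indicators is a lower bound for each truncation level \<open>J\<close>, and is exact
  once the level exceeds all valuations in the range. For the range up to \<open>N\<close> the level \<open>L\<close> of size
  \<open>O(log N)\<close> suffices, so the rounding errors of the residue class counts are negligible against
  \<open>N\<close>.
\<close>

lemma mean_ord_in_Zp:
  assumes "algebraic x" "x \<in> Zp v"
  shows "\<forall>\<^sub>F m in sequentially.
    (\<lambda>N. (\<Sum>i=m..N. ord (x - of_nat i)) / real N) \<longlonglongrightarrow> 1 / (real p - 1)"
proof -
  have vx: "v x \<le> 1" using assms(2) by (simp add: Zp_def)
  obtain C d M where C: "C \<ge> 1" and M: "\<And>i. i \<ge> M \<Longrightarrow> x \<noteq> of_nat i"
    and bound: "\<And>i. i \<ge> M \<Longrightarrow> ord (x - of_nat i) \<le> log (real p) (C * (real i + 1) ^ d)"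
    using ord_diff_nat_log_bound[OF assms(1) vx] by blast
  define B where "B N = log (real p) (C * (real N + 1) ^ d)" for N :: nat
  \<comment> \<open>\<open>a j\<close> represents the class of \<open>x\<close> modulo \<open>p\<^sup>j\<close>.\<close>
  obtain a where a: "\<And>j. v (x - of_nat (a j)) \<le> 1 / real p ^ j"
    using assms(2) unfolding in_Zp_iff by metis
  have "(\<lambda>N. (\<Sum>i=m..N. ord (x - of_nat i)) / real N) \<longlonglongrightarrow> 1 / (real p - 1)"
    if m: "m \<ge> M" for m
  proof (rule order_tendstoI)
    define c where "c j N = (\<Sum>i=m..N. of_bool (int p ^ j dvd int i - int (a j)) :: real)" for j N
    have sum_eq: "(\<Sum>j=1..J. c j N) =
        (\<Sum>i=m..N. \<Sum>j=1..J. of_bool (real j \<le> ord (x - of_nat i)))" for J N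
    proof -
      have "(\<Sum>i=m..N. \<Sum>j=1..J. of_bool (real j \<le> ord (x - of_nat i))) =
         (\<Sum>j=1..J. \<Sum>i=m..N. of_bool (real j \<le> ord (x - of_nat i)) :: real)"
        by (rule sum.swap)
      also have "\<dots> = (\<Sum>j=1..J. c j N)"
        unfolding c_def
        using nat_le_ord_iff_residue[OF M a] m
        by (intro sum.cong refl) auto
      finally show ?thesis by simp
    qed
    have nat: "\<exists>n. ord (x - of_nat i) = real n" if "i \<ge> m" for i
      using ord_in_Zp_is_nat[OF assms(2) M] m that by simp
    have lower: "(\<Sum>j=1..J. c j N) \<le> (\<Sum>i=m..N. ord (x - of_nat i))" for J N
      unfolding sum_eq
    proof (rule sum_mono)
      fix i assume "i \<in> {m..N}"
      then obtain n where n: "ord (x - of_nat i) = real n" using nat by auto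
      show "(\<Sum>j=1..J. of_bool (real j \<le> ord (x - of_nat i))) \<le> ord (x - of_nat i)"
        unfolding n of_nat_le_iff sum_of_bool_le by simp
    qed
    have upper: "(\<Sum>i=m..N. ord (x - of_nat i)) \<le> (real N + 1) / (real p - 1) + B N"
      if N: "N \<ge> m" for N
    proof -
      define L where "L = nat \<lfloor>B N\<rfloor>"
      have B0: "B N \<ge> 0"
      proof -
        have "1 * 1 \<le> C * (real N + 1) ^ d" using C by (intro mult_mono) auto
        then show ?thesis using p_gt_1 by (simp add: B_def)
      qed
      have "(\<Sum>i=m..N. ord (x - of_nat i)) = (\<Sum>j=1..L. c j N)"
        unfolding sum_eq
      proof (rule sum.cong[OF refl])
        fix i assume i: "i \<in> {m..N}"
        then obtain n where n: "ord (x - of_nat i) = real n" using nat by auto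
        have "real n \<le> log (real p) (C * (real i + 1) ^ d)"
          using bound[of i] i m n by simp
        also have "\<dots> \<le> B N"
          unfolding B_def using p_gt_1 C i
          by (subst log_le_cancel_iff) (auto intro!: mult_left_mono power_mono)
        finally have "n \<le> L" by (simp add: L_def le_nat_floor)
        then show "ord (x - of_nat i) = (\<Sum>j=1..L. of_bool (real j \<le> ord (x - of_nat i)))"
          unfolding n of_nat_le_iff sum_of_bool_le by simp
      qed
      also have "\<dots> \<le> (\<Sum>j=1..L. (real N + 1) * (1 / real p ^ j) + 1)"
      proof (rule sum_mono)
        fix j
        have "c j N \<le> (real N + 1 - real m) / real p ^ j + 1"
          using residue_class_count_bounds[of "int p ^ j" m N "int (a j)"] p_gt_1 N
          by (simp add: c_def)
        also have "(real N + 1 - real m) / real p ^ j \<le> (real N + 1) * (1 / real p ^ j)"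
          by (simp add: divide_right_mono)
        finally show "c j N \<le> (real N + 1) * (1 / real p ^ j) + 1" by simp
      qed
      also have "\<dots> = (real N + 1) * ((1 - 1 / real p ^ L) / (real p - 1)) + real L"
        unfolding sum.distrib sum_distrib_left[symmetric] sum_inverse_powers[OF p_gt_1] by simp
      also have "\<dots> \<le> (real N + 1) * (1 / (real p - 1)) + B N"
        using B0 p_gt_1
        by (intro add_mono mult_left_mono divide_right_mono) (auto simp: L_def)
      finally show ?thesis by simp
    qed
    fix y
    {
      assume y: "y < 1 / (real p - 1)"
      have "(\<lambda>J. (1 - 1 / real p ^ J) / (real p - 1)) \<longlonglongrightarrow> (1 - 0) / (real p - 1)"
        using p_gt_1 LIMSEQ_inverse_realpow_zero[OF p_gt_1]
        by (intro tendsto_intros) (auto simp: inverse_eq_divide)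
      then have "\<forall>\<^sub>F J in sequentially. y < (1 - 1 / real p ^ J) / (real p - 1)"
        using y by (intro order_tendstoD(1)) auto
      then obtain J where J: "y < (\<Sum>j=1..J. 1 / real p ^ j)"
        unfolding sum_inverse_powers[OF p_gt_1] by (auto simp: eventually_sequentially)
      have "(\<lambda>N. \<Sum>j=1..J. c j N / real N) \<longlonglongrightarrow> (\<Sum>j=1..J. 1 / real p ^ j)"
        unfolding c_def using residue_class_density[of "int p ^ j" "int (a j)" m for j] p_gt_1
        by (intro tendsto_sum) simp
      then have "\<forall>\<^sub>F N in sequentially. y < (\<Sum>j=1..J. c j N / real N)"
        using J by (rule order_tendstoD(1))
      then show "\<forall>\<^sub>F N in sequentially. y < (\<Sum>i=m..N. ord (x - of_nat i)) / real N"
      proof eventually_elim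
        case (elim N)
        also have "(\<Sum>j=1..J. c j N / real N) \<le> (\<Sum>i=m..N. ord (x - of_nat i)) / real N"
          unfolding sum_divide_distrib[symmetric] using lower by (rule divide_right_mono) simp
        finally show ?case .
      qed
    next
      assume y: "1 / (real p - 1) < y"
      define P where "P = real p"
      have P: "P > 1" using p_gt_1 by (simp add: P_def)
      have "(\<lambda>N. ((real N + 1) / (P - 1) + log P (C * (real N + 1) ^ d)) / real N) \<longlonglongrightarrow> 1 / (P - 1)"
      proof -
        have "log P (C * (real N + 1) ^ d) = (ln C + real d * ln (real N + 1)) / ln P" for N :: nat
          using C by (simp add: log_def ln_mult ln_realpow)
        moreover have "(\<lambda>N. ((real N + 1) / (P - 1) + (ln C + real d * ln (real N + 1)) / ln P) / real N)
            \<longlonglongrightarrow> 1 / (P - 1)"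
          using P by (real_asymp simp: divide_inverse)
        ultimately show ?thesis by simp
      qed
      then have "\<forall>\<^sub>F N in sequentially. ((real N + 1) / (real p - 1) + B N) / real N < y"
        using y unfolding P_def B_def by (rule order_tendstoD(2))
      then show "\<forall>\<^sub>F N in sequentially. (\<Sum>i=m..N. ord (x - of_nat i)) / real N < y"
        using eventually_ge_at_top[of m]
      proof eventually_elim
        case (elim N)
        have "(\<Sum>i=m..N. ord (x - of_nat i)) / real N \<le> ((real N + 1) / (real p - 1) + B N) / real N"
          using upper[OF elim(2)] by (rule divide_right_mono) simp
        then show ?case using elim(1) by simp
      qed
    }
  qed
  then show ?thesis by (auto simp: eventually_sequentially)
qed

section \<open>Outside the unit disc\<close>

lemma mean_ord_outside_disc:
  assumes "v x > 1"
  shows "(\<lambda>N. (\<Sum>i=m..N. ord (x - of_nat i)) / real N) \<longlonglongrightarrow> ord x"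
proof -
  have ord_eq: "ord (x - of_nat i) = ord x" for i
    using v_diff_eq[of 0 "of_nat i" x] assms v_of_nat_le_1[of i] v_minus_commute[of x "of_nat i"]
    by (simp add: ord_def v_minus)
  have "\<forall>\<^sub>F N in sequentially. (\<Sum>i=m..N. ord (x - of_nat i)) / real N =
      (real N + 1 - real m) / real N * ord x"
    using eventually_ge_at_top[of m] by eventually_elim (simp add: ord_eq of_nat_diff)
  moreover have "(\<lambda>N. (real N + 1 - real m) / real N * ord x) \<longlonglongrightarrow> 1 * ord x"
    by (intro tendsto_mult tendsto_const) real_asymp
  ultimately show ?thesis unfolding mult_1_left by (rule iffD2[OF tendsto_cong])
qed

section \<open>The weight\<close>

lemma ereal_mean_tendsto:
  assumes "\<And>i. i \<ge> m \<Longrightarrow> x \<noteq> of_nat i"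
    and "(\<lambda>N. (\<Sum>i=m..N. ord (x - of_nat i)) / real N) \<longlonglongrightarrow> l"
  shows "(\<lambda>N. (\<Sum>i=m..N. padic_ord p v (x - of_nat i)) / ereal (real N)) \<longlonglongrightarrow> ereal l"
proof -
  have "(\<Sum>i=m..N. padic_ord p v (x - of_nat i)) = ereal (\<Sum>i=m..N. ord (x - of_nat i))" for N
    unfolding sum_ereal[symmetric] using assms(1) by (intro sum.cong refl padic_ord_eq) auto
  then have "\<forall>\<^sub>F N in sequentially. ereal ((\<Sum>i=m..N. ord (x - of_nat i)) / real N) =
     (\<Sum>i=m..N. padic_ord p v (x - of_nat i)) / ereal (real N)"
    by (intro eventually_mono[OF eventually_gt_at_top[of 0]]) simp
  with tendsto_ereal[OF assms(2)] show ?thesis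
    by (rule Lim_transform_eventually)
qed

lemma padic_r_eq_nearest:
  assumes "\<And>i. x \<noteq> of_nat i" "\<And>i. v (x - of_nat a) \<le> v (x - of_nat i)"
  shows "padic_r p v x = ereal (ord (x - of_nat a))"
  unfolding padic_r_def
proof (rule antisym)
  show "(SUP i. padic_ord p v (x - of_nat i)) \<le> ereal (ord (x - of_nat a))"
    using assms by (intro SUP_least) (simp add: padic_ord_eq ord_le_iff)
  show "ereal (ord (x - of_nat a)) \<le> (SUP i. padic_ord p v (x - of_nat i))"
    using assms(1) by (intro SUP_upper2[of a]) (auto simp: padic_ord_eq)
qed

end

theorem lemma2p5:
  fixes p :: nat and v :: "'k::field_char_0 \<Rightarrow> real" and \<alpha> :: 'k
  assumes "prime p"
    and "is_Cp p v"
    and "algebraic \<alpha> \<or> \<alpha> \<notin> Zp v"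
  shows "\<forall>\<^sub>F m in sequentially.
           (\<lambda>N. (\<Sum>i=m..N. padic_ord p v (\<alpha> - of_nat i)) / ereal (real N))
             \<longlonglongrightarrow> ereal (padic_weight p v \<alpha>)"
proof -
  interpret padic_absolute_value p v
    using assms(1,2) unfolding is_Cp_def by unfold_locales auto
  consider (Zp) "\<alpha> \<in> Zp v" | (disc) "v \<alpha> \<le> 1" "\<alpha> \<notin> Zp v" | (outside) "v \<alpha> > 1"
    by linarith
  then show ?thesis
  proof cases
    case Zp
    then have alg: "algebraic \<alpha>" using assms(3) by simp
    have "v \<alpha> \<le> 1" using Zp by (simp add: Zp_def)
    then obtain M where "\<And>i. i \<ge> M \<Longrightarrow> \<alpha> \<noteq> of_nat i"
      using ord_diff_nat_log_bound[OF alg] by blast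
    then have "\<forall>\<^sub>F m in sequentially. \<forall>i\<ge>m. \<alpha> \<noteq> of_nat i"
      unfolding eventually_sequentially by (meson order_trans)
    with mean_ord_in_Zp[OF alg Zp] have "\<forall>\<^sub>F m in sequentially.
        (\<lambda>N. (\<Sum>i=m..N. padic_ord p v (\<alpha> - of_nat i)) / ereal (real N))
          \<longlonglongrightarrow> ereal (1 / (real p - 1))"
      by eventually_elim (intro ereal_mean_tendsto, blast+)
    then show ?thesis using Zp by (simp add: padic_weight_def)
  next
    case disc
    obtain a where a: "\<And>i. v (\<alpha> - of_nat a) \<le> v (\<alpha> - of_nat i)"
      using nearest_nat_exists[OF disc] by blast
    define r where "r = ord (\<alpha> - of_nat a)"
    have ne: "\<alpha> \<noteq> of_nat i" for i using disc(2) of_nat_in_Zp by auto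
    have "r \<ge> 0"
      unfolding r_def using ne a[of 0] disc(1) by (intro ord_nonneg) auto
    then have K: "\<lfloor>r\<rfloor> = int (nat \<lfloor>r\<rfloor>)" by simp
    have "padic_weight p v \<alpha> =
        (1 - real p powi (- \<lfloor>r\<rfloor>)) / (real p - 1) + frac r * real p powi (- \<lfloor>r\<rfloor> - 1)"
      using disc by (simp add: padic_weight_def unit_disc_def padic_r_eq_nearest[OF ne a] r_def Let_def)
    also have "real p powi (- \<lfloor>r\<rfloor>) = 1 / real p ^ nat \<lfloor>r\<rfloor>"
      using power_int_of_nat[of "real p" "nat \<lfloor>r\<rfloor>"] K
      by (simp add: power_int_minus inverse_eq_divide)
    also have "- \<lfloor>r\<rfloor> - 1 = - int (Suc (nat \<lfloor>r\<rfloor>))" using K by simp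
    also have "real p powi (- int (Suc (nat \<lfloor>r\<rfloor>))) = 1 / real p ^ Suc (nat \<lfloor>r\<rfloor>)"
      by (simp only: power_int_minus inverse_eq_divide power_int_of_nat)
    finally have w: "padic_weight p v \<alpha> = (1 - 1 / real p ^ nat \<lfloor>r\<rfloor>) / (real p - 1) +
        frac r / real p ^ Suc (nat \<lfloor>r\<rfloor>)"
      by simp
    show ?thesis
      unfolding w r_def
      by (intro always_eventually allI ereal_mean_tendsto ne mean_ord_outside_Zp disc a)
  next
    case outside
    then have "\<alpha> \<notin> Zp v" "\<alpha> \<notin> unit_disc v" "\<alpha> \<noteq> 0"
      by (auto simp: Zp_def unit_disc_def)
    then have w: "padic_weight p v \<alpha> = ord \<alpha>"
      by (simp add: padic_weight_def padic_ord_eq)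
    have "\<alpha> \<noteq> of_nat i" for i using outside v_of_nat_le_1[of i] by auto
    then show ?thesis
      unfolding w by (intro always_eventually allI ereal_mean_tendsto mean_ord_outside_disc outside)
  qed
qed

end
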